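(* Let $\mathbf S=(S,\lambda_S)$ and $\mathbf F=(F,\lambda_F)$ be topological left unosemigroups and let $\alpha:F\times S\to S$ be a continuous action of $F$ on $S$ which respects the left unit operation $\lambda_F$, i.e. $\alpha(\lambda_F(f),s)=s$ for all $(f,s)\in F\times S$. Then the topological left unosemigroup $\mathbf S\times_\alpha\mathbf F$ (the semidirect product) is ditopological if and only if both topological left unosemigroups $\mathbf S$ and $\mathbf F$ are ditopological.
   Context: A topological semigroup is a non-empty topological space $S$ endowed with a continuous associative binary operation $\cdot:S\times S\to S$. A left unit operation on $S$ is a map $\lambda:S\to S$ with $\lambda(x)\cdot x=x$ for all $x\in S$. A topological left unosemigroup $(S,\lambda)$ is a topological semigroup $S$ with a continuous left unit operation $\lambda$. For $A,B\subset S$ put $A\leftthreetimes B=\{x\in S: ax\in B \text{ for some } a\in A\}$. A continuous left unit operation $\lambda$ is dicontinuous if for every $x\in S$ and every neighborhood $O_x\subset S$ of $x$ there are a neighborhood $U_x\subset S$ of $x$ and a neighborhood $W_{\lambda(x)}\subset\lambda(S)$ of $\lambda(x)$ in the subspace $\lambda(S)$ such that $(W_{\lambda(x)}\leftthreetimes U_x)\cap\lambda^{-1}(W_{\lambda(x)})\subset O_x$. A topological left unosemigroup $(S,\lambda)$ is ditopological if $\lambda$ is dicontinuous. A continuous action of a topological semigroup $F$ on a topological semigroup $S$ is a continuous map $\alpha:F\times S\to S$ such that for each $f\in F$ the map $\alpha_f:S\to S$, $\alpha_f(x)=\alpha(f,x)$, is a semigroup homomorphism, and $\alpha_{fg}=\alpha_f\circ\alpha_g$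 for all $f,g\in F$. The semidirect product $S\times_\alpha F$ is the product space $S\times F$ with the operation $(s,f)\cdot(t,g)=(s\cdot\alpha_f(t),f\cdot g)$. When $\alpha$ respects $\lambda_F$, the map $\lambda(s,f)=(\lambda_S(s),\lambda_F(f))$ is a continuous left unit operation on $S\times_\alpha F$, and $\mathbf S\times_\alpha\mathbf F=(S\times_\alpha F,\lambda)$. *)

theory Defs
  imports "HOL-Analysis.Product_Topology"
begin

text \<open>
  Topological semigroups are given by a topology with explicit carrier \<open>topspace S\<close> and an explicit
  operation, since the multiplication of a semidirect product depends on the action. Algebraic laws
  are required on the carriers only; closure of the carriers under an operation is part of
  \<^const>\<open>continuous_map\<close>.
\<close>

locale topological_semigroup =
  fixes S :: "'a topology"
    and mul :: "'a \<Rightarrow> 'a \<Rightarrow> 'a"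
  assumes nonempty: "topspace S \<noteq> {}"
    and continuous_mul: "continuous_map (prod_topology S S) S (\<lambda>(x, y). mul x y)"
    and assoc: "\<And>x y z. \<lbrakk>x \<in> topspace S; y \<in> topspace S; z \<in> topspace S\<rbrakk>
      \<Longrightarrow> mul (mul x y) z = mul x (mul y z)"

locale topological_left_unosemigroup = topological_semigroup S mul
  for S :: "'a topology" and mul :: "'a \<Rightarrow> 'a \<Rightarrow> 'a" +
  fixes lam :: "'a \<Rightarrow> 'a"
  assumes continuous_lam: "continuous_map S S lam"
    and left_unit: "\<And>x. x \<in> topspace S \<Longrightarrow> mul (lam x) x = x"

text \<open>Neighborhoods need not be open.\<close>

definition neighborhood :: "'a topology \<Rightarrow> 'a \<Rightarrow> 'a set \<Rightarrow> bool" where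
  "neighborhood X x U \<longleftrightarrow> U \<subseteq> topspace X \<and> x \<in> X interior_of U"

text \<open>The set \<open>A \<leftthreetimes> B\<close> in the semigroup with carrier \<open>topspace S\<close>.\<close>

definition left_division ::
    "'a topology \<Rightarrow> ('a \<Rightarrow> 'a \<Rightarrow> 'a) \<Rightarrow> 'a set \<Rightarrow> 'a set \<Rightarrow> 'a set" where
  "left_division S mul A B = {x \<in> topspace S. \<exists>a\<in>A. mul a x \<in> B}"

definition dicontinuous ::
    "'a topology \<Rightarrow> ('a \<Rightarrow> 'a \<Rightarrow> 'a) \<Rightarrow> ('a \<Rightarrow> 'a) \<Rightarrow> bool" where
  "dicontinuous S mul lam \<longleftrightarrow>
    (\<forall>x \<in> topspace S. \<forall>Ox. neighborhood S x Ox \<longrightarrow>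
      (\<exists>U W. neighborhood S x U \<and>
        neighborhood (subtopology S (lam ` topspace S)) (lam x) W \<and>
        left_division S mul W U \<inter> {y \<in> topspace S. lam y \<in> W} \<subseteq> Ox))"

locale ditopological_left_unosemigroup = topological_left_unosemigroup S mul lam
  for S :: "'a topology" and mul :: "'a \<Rightarrow> 'a \<Rightarrow> 'a" and lam :: "'a \<Rightarrow> 'a" +
  assumes dicontinuous_lam: "dicontinuous S mul lam"

locale continuous_semigroup_action =
  F: topological_semigroup F mulF + S: topological_semigroup S mulS
  for F :: "'f topology" and mulF :: "'f \<Rightarrow> 'f \<Rightarrow> 'f"
    and S :: "'s topology" and mulS :: "'s \<Rightarrow> 's \<Rightarrow> 's" +
  fixes \<alpha> :: "'f \<Rightarrow> 's \<Rightarrow> 's"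
  assumes continuous_action: "continuous_map (prod_topology F S) S (\<lambda>(f, s). \<alpha> f s)"
    and action_hom: "\<And>f s t. \<lbrakk>f \<in> topspace F; s \<in> topspace S; t \<in> topspace S\<rbrakk>
      \<Longrightarrow> \<alpha> f (mulS s t) = mulS (\<alpha> f s) (\<alpha> f t)"
    and action_mul: "\<And>f g s. \<lbrakk>f \<in> topspace F; g \<in> topspace F; s \<in> topspace S\<rbrakk>
      \<Longrightarrow> \<alpha> (mulF f g) s = \<alpha> f (\<alpha> g s)"

definition semidirect_mul ::
    "('s \<Rightarrow> 's \<Rightarrow> 's) \<Rightarrow> ('f \<Rightarrow> 'f \<Rightarrow> 'f) \<Rightarrow> ('f \<Rightarrow> 's \<Rightarrow> 's) \<Rightarrow> 's \<times> 'f \<Rightarrow> 's \<times> 'f \<Rightarrow> 's \<times> 'f" where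
  "semidirect_mul mulS mulF \<alpha> = (\<lambda>(s, f) (t, g). (mulS s (\<alpha> f t), mulF f g))"

end

theory Submission
  imports Defs
begin

text \<open>
  Every element of \<open>\<lambda>\<^sub>F(F)\<close> acts trivially on \<open>S\<close>, so left translations by elements of the
  image of \<open>\<lambda>\<close> act on \<open>S \<times> F\<close> coordinatewise. Since dicontinuity only involves such translations,
  the semidirect product may be replaced by the direct product, whose dicontinuity can be
  checked on boxes. To recover a factor, freeze the other coordinate at a point \<open>f\<close> and translate
  by \<open>\<lambda>(f)\<close>, which fixes \<open>f\<close>.
\<close>

lemma neighborhood_openin: "openin X U \<Longrightarrow> x \<in> U \<Longrightarrow> neighborhood X x U"
  by (simp add: neighborhood_def interior_of_openin openin_subset)

lemma dicontinuous_iff_openin: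
  "dicontinuous S mul lam \<longleftrightarrow>
    (\<forall>x Q. openin S Q \<longrightarrow> x \<in> Q \<longrightarrow>
      (\<exists>U V. openin S U \<and> x \<in> U \<and> openin S V \<and> lam x \<in> V \<and>
        (\<forall>y \<in> topspace S. \<forall>a \<in> V \<inter> lam ` topspace S.
          mul a y \<in> U \<longrightarrow> lam y \<in> V \<longrightarrow> y \<in> Q)))"
  (is "?L \<longleftrightarrow> ?R")
proof
  assume L: ?L
  show ?R
  proof (intro allI impI)
    fix x Q assume Q: "openin S Q" "x \<in> Q"
    then have "x \<in> topspace S"
      using openin_subset by blast
    with L neighborhood_openin[OF Q] obtain U W where U: "neighborhood S x U"
      and W: "neighborhood (subtopology S (lam ` topspace S)) (lam x) W"
      and sub: "left_division S mul W U \<inter> {y \<in> topspace S. lam y \<in> W} \<subseteq> Q"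
      unfolding dicontinuous_def by blast
    \<comment> \<open>\<open>T\<close> is open in the image of \<open>lam\<close> only;
      \<open>V\<close> is an open set of \<open>S\<close> with trace \<open>T\<close>.\<close>
    from W obtain T where "openin (subtopology S (lam ` topspace S)) T" "lam x \<in> T" "T \<subseteq> W"
      unfolding neighborhood_def interior_of_def by blast
    then obtain V where V: "openin S V" "lam x \<in> V" "V \<inter> lam ` topspace S \<subseteq> W"
      unfolding openin_subtopology by blast
    from U obtain U' where U': "openin S U'" "x \<in> U'" "U' \<subseteq> U"
      unfolding neighborhood_def interior_of_def by blast
    \<comment> \<open>Passing from \<open>U\<close> to \<open>U'\<close> and from \<open>W\<close>
      to the trace of \<open>V\<close> only shrinks the set of admissible \<open>y\<close>, so it
      stays inside \<open>Q\<close>.\<close>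
    have "\<forall>y \<in> topspace S. \<forall>a \<in> V \<inter> lam ` topspace S.
        mul a y \<in> U' \<longrightarrow> lam y \<in> V \<longrightarrow> y \<in> Q"
      using sub V(3) U'(3) unfolding left_division_def by blast
    with V U' show "\<exists>U V. openin S U \<and> x \<in> U \<and> openin S V \<and> lam x \<in> V \<and>
        (\<forall>y \<in> topspace S. \<forall>a \<in> V \<inter> lam ` topspace S.
          mul a y \<in> U \<longrightarrow> lam y \<in> V \<longrightarrow> y \<in> Q)"
      by blast
  qed
next
  assume R: ?R
  show ?L
    unfolding dicontinuous_def
  proof (intro ballI allI impI)
    fix x Q assume x: "x \<in> topspace S" and "neighborhood S x Q"
    then obtain Q' where Q': "openin S Q'" "x \<in> Q'" "Q' \<subseteq> Q"
      unfolding neighborhood_def interior_of_def by blast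
    from R[rule_format, OF Q'(1,2)]
    obtain U V where U: "openin S U" "x \<in> U" and V: "openin S V" "lam x \<in> V"
      and sub: "\<forall>y \<in> topspace S. \<forall>a \<in> V \<inter> lam ` topspace S.
          mul a y \<in> U \<longrightarrow> lam y \<in> V \<longrightarrow> y \<in> Q'"
      by (elim exE conjE) (rule that)
    let ?W = "V \<inter> lam ` topspace S"
    have "openin (subtopology S (lam ` topspace S)) ?W"
      using V(1) by (auto simp: openin_subtopology)
    then have "neighborhood (subtopology S (lam ` topspace S)) (lam x) ?W"
      using V(2) x by (intro neighborhood_openin) simp_all
    moreover have "neighborhood S x U"
      using U by (rule neighborhood_openin)
    moreover have "left_division S mul ?W U \<inter> {y \<in> topspace S. lam y \<in> ?W} \<subseteq> Q"
      using sub Q'(3) unfolding left_division_def by blast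
    ultimately show "\<exists>U W. neighborhood S x U \<and>
        neighborhood (subtopology S (lam ` topspace S)) (lam x) W \<and>
        left_division S mul W U \<inter> {y \<in> topspace S. lam y \<in> W} \<subseteq> Q"
      by blast
  qed
qed

text \<open>This is what allows the twisted multiplication to be exchanged for the direct one: the
  two agree when the left factor is a value of the unit operation, though not in general.\<close>

lemma dicontinuous_cong:
  assumes "\<And>a x. \<lbrakk>a \<in> lam ` topspace S; x \<in> topspace S\<rbrakk> \<Longrightarrow> mul a x = mul' a x"
  shows "dicontinuous S mul lam \<longleftrightarrow> dicontinuous S mul' lam"
  unfolding dicontinuous_iff_openin using assms by simp

definition direct_mul ::
    "('s \<Rightarrow> 's \<Rightarrow> 's) \<Rightarrow> ('f \<Rightarrow> 'f \<Rightarrow> 'f) \<Rightarrow> 's \<times> 'f \<Rightarrow> 's \<times> 'f \<Rightarrow> 's \<times> 'f" where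
  "direct_mul mulS mulF = (\<lambda>(s, f) (t, g). (mulS s t, mulF f g))"

text \<open>Shrink the target to a box \<open>A \<times> B\<close> and apply dicontinuity in each
  coordinate. For the products of the resulting open sets, both membership conditions split into a
  condition on each coordinate.\<close>

lemma dicontinuous_direct_mul:
  assumes "dicontinuous S mulS lamS" and "dicontinuous F mulF lamF"
  shows "dicontinuous (prod_topology S F) (direct_mul mulS mulF) (map_prod lamS lamF)"
  unfolding dicontinuous_iff_openin
proof (intro allI impI)
  fix p Q assume Q: "openin (prod_topology S F) Q" "p \<in> Q"
  obtain x f where p: "p = (x, f)" by (rule prod.exhaust)
  obtain A B where AB: "openin S A" "openin F B" "x \<in> A" "f \<in> B" "A \<times> B \<subseteq> Q"
    using Q unfolding p openin_prod_topology_alt by meson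
  from assms(1)[unfolded dicontinuous_iff_openin, rule_format, OF AB(1,3)]
  obtain U V where UV: "openin S U" "x \<in> U" "openin S V" "lamS x \<in> V"
    "\<forall>y \<in> topspace S. \<forall>a \<in> V \<inter> lamS ` topspace S. mulS a y \<in> U \<longrightarrow> lamS y \<in> V \<longrightarrow> y \<in> A"
    by (elim exE conjE) (rule that)
  from assms(2)[unfolded dicontinuous_iff_openin, rule_format, OF AB(2,4)]
  obtain U' V' where UV': "openin F U'" "f \<in> U'" "openin F V'" "lamF f \<in> V'"
    "\<forall>y \<in> topspace F. \<forall>a \<in> V' \<inter> lamF ` topspace F. mulF a y \<in> U' \<longrightarrow> lamF y \<in> V' \<longrightarrow> y \<in> B"
    by (elim exE conjE) (rule that)
  have *: "\<forall>y \<in> topspace (prod_topology S F).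
      \<forall>a \<in> (V \<times> V') \<inter> map_prod lamS lamF ` topspace (prod_topology S F).
        direct_mul mulS mulF a y \<in> U \<times> U' \<longrightarrow> map_prod lamS lamF y \<in> V \<times> V' \<longrightarrow> y \<in> Q"
  proof (intro ballI impI)
    fix y a assume "y \<in> topspace (prod_topology S F)"
      and "a \<in> (V \<times> V') \<inter> map_prod lamS lamF ` topspace (prod_topology S F)"
      and "direct_mul mulS mulF a y \<in> U \<times> U'" "map_prod lamS lamF y \<in> V \<times> V'"
    \<comment> \<open>Since \<open>a\<close> is a value of \<open>map_prod lamS lamF\<close>, its
      components are values of \<open>lamS\<close> and \<open>lamF\<close>, and serve as the left
      factors in the two coordinates.\<close>
    then have "fst y \<in> A" "snd y \<in> B"
      by (auto simp: direct_mul_def 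
          intro!: UV(5)[rule_format, of _ "fst a"] UV'(5)[rule_format, of _ "snd a"])
    then show "y \<in> Q"
      using AB(5) by (auto simp: mem_Times_iff)
  qed
  have **: "openin (prod_topology S F) (U \<times> U')" "openin (prod_topology S F) (V \<times> V')"
    using UV(1,3) UV'(1,3) by (simp_all add: openin_prod_Times_iff)
  have "p \<in> U \<times> U'" "map_prod lamS lamF p \<in> V \<times> V'"
    using UV(2,4) UV'(2,4) p by simp_all
  with ** show "\<exists>U V. openin (prod_topology S F) U \<and> p \<in> U \<and>
      openin (prod_topology S F) V \<and> map_prod lamS lamF p \<in> V \<and>
      (\<forall>y \<in> topspace (prod_topology S F).
        \<forall>a \<in> V \<inter> map_prod lamS lamF ` topspace (prod_topology S F).
          direct_mul mulS mulF a y \<in> U \<longrightarrow> map_prod lamS lamF y \<in> V \<longrightarrow> y \<in> Q)"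
    using * by (intro exI[of _ "U \<times> U'"] exI[of _ "V \<times> V'"] conjI)
qed

text \<open>Dicontinuity is applied at \<open>(x, f)\<close> to the cylinder over \<open>Q\<close>.
  Left translation by \<open>(a, lamF f)\<close> maps the slice of points \<open>(y, f)\<close> into
  itself and acts there as translation by \<open>a\<close>, so the condition restricts to the first
  factor.\<close>

lemma dicontinuous_direct_mul_fst:
  assumes "dicontinuous (prod_topology S F) (direct_mul mulS mulF) (map_prod lamS lamF)"
    and f: "f \<in> topspace F" "mulF (lamF f) f = f"
  shows "dicontinuous S mulS lamS"
  unfolding dicontinuous_iff_openin
proof (intro allI impI)
  fix x Q assume Q: "openin S Q" "x \<in> Q"
  have "openin (prod_topology S F) (Q \<times> topspace F)" "(x, f) \<in> Q \<times> topspace F"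
    using Q f by (auto simp: openin_prod_Times_iff)
  from assms(1)[unfolded dicontinuous_iff_openin, rule_format, OF this]
  obtain U V where U: "openin (prod_topology S F) U" "(x, f) \<in> U"
    and V: "openin (prod_topology S F) V" "(lamS x, lamF f) \<in> V"
    and sub: "\<forall>y \<in> topspace (prod_topology S F).
        \<forall>a \<in> V \<inter> map_prod lamS lamF ` topspace (prod_topology S F).
          direct_mul mulS mulF a y \<in> U \<longrightarrow> map_prod lamS lamF y \<in> V \<longrightarrow> y \<in> Q \<times> topspace F"
    unfolding map_prod_simp by (elim exE conjE) (rule that)
  \<comment> \<open>The first sides \<open>A\<close> and \<open>C\<close> of the boxes are the open
    sets sought in \<open>S\<close>; the second sides serve to contain \<open>f\<close> and
    \<open>lamF f\<close>.\<close>
  obtain A B where A: "openin S A" "x \<in> A" "f \<in> B" "A \<times> B \<subseteq> U"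
    using U unfolding openin_prod_topology_alt by meson
  obtain C D where C: "openin S C" "lamS x \<in> C" "lamF f \<in> D" "C \<times> D \<subseteq> V"
    using V unfolding openin_prod_topology_alt by meson
  have "y \<in> Q"
    if y: "y \<in> topspace S" "mulS a y \<in> A" "lamS y \<in> C" and a: "a \<in> C \<inter> lamS ` topspace S" for y a
  proof -
    have "(y, f) \<in> topspace (prod_topology S F)"
      using y f by simp
    moreover have "(a, lamF f) \<in> V \<inter> map_prod lamS lamF ` topspace (prod_topology S F)"
      using a C f by auto
    \<comment> \<open>The product is \<open>(mulS a y, f)\<close>, a point of
      \<open>A \<times> B\<close>.\<close>
    moreover have "direct_mul mulS mulF (a, lamF f) (y, f) \<in> U"
      using y A f by (auto simp: direct_mul_def)
    moreover have "map_prod lamS lamF (y, f) \<in> V"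
      using y C by auto
    ultimately have "(y, f) \<in> Q \<times> topspace F"
      by (rule sub[rule_format])
    then show ?thesis by simp
  qed
  then have *: "\<forall>y \<in> topspace S. \<forall>a \<in> C \<inter> lamS ` topspace S. mulS a y \<in> A \<longrightarrow> lamS y \<in> C \<longrightarrow> y \<in> Q"
    by blast
  show "\<exists>U V. openin S U \<and> x \<in> U \<and> openin S V \<and> lamS x \<in> V \<and>
      (\<forall>y \<in> topspace S. \<forall>a \<in> V \<inter> lamS ` topspace S. mulS a y \<in> U \<longrightarrow> lamS y \<in> V \<longrightarrow> y \<in> Q)"
    by (intro exI conjI) (fact A(1) A(2) C(1) C(2) *)+
qed

text \<open>The mirror image of the previous argument: the first coordinate is frozen at
  \<open>s\<close> and translated by \<open>lamS s\<close>.\<close>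

lemma dicontinuous_direct_mul_snd:
  assumes "dicontinuous (prod_topology S F) (direct_mul mulS mulF) (map_prod lamS lamF)"
    and s: "s \<in> topspace S" "mulS (lamS s) s = s"
  shows "dicontinuous F mulF lamF"
  unfolding dicontinuous_iff_openin
proof (intro allI impI)
  fix x Q assume Q: "openin F Q" "x \<in> Q"
  have "openin (prod_topology S F) (topspace S \<times> Q)" "(s, x) \<in> topspace S \<times> Q"
    using Q s by (auto simp: openin_prod_Times_iff)
  from assms(1)[unfolded dicontinuous_iff_openin, rule_format, OF this]
  obtain U V where U: "openin (prod_topology S F) U" "(s, x) \<in> U"
    and V: "openin (prod_topology S F) V" "(lamS s, lamF x) \<in> V"
    and sub: "\<forall>y \<in> topspace (prod_topology S F).
        \<forall>a \<in> V \<inter> map_prod lamS lamF ` topspace (prod_topology S F).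
          direct_mul mulS mulF a y \<in> U \<longrightarrow> map_prod lamS lamF y \<in> V \<longrightarrow> y \<in> topspace S \<times> Q"
    unfolding map_prod_simp by (elim exE conjE) (rule that)
  obtain A B where B: "openin F B" "s \<in> A" "x \<in> B" "A \<times> B \<subseteq> U"
    using U unfolding openin_prod_topology_alt by meson
  obtain C D where D: "openin F D" "lamS s \<in> C" "lamF x \<in> D" "C \<times> D \<subseteq> V"
    using V unfolding openin_prod_topology_alt by meson
  have "y \<in> Q"
    if y: "y \<in> topspace F" "mulF a y \<in> B" "lamF y \<in> D" and a: "a \<in> D \<inter> lamF ` topspace F" for y a
  proof -
    have "(s, y) \<in> topspace (prod_topology S F)"
      using y s by simp
    moreover have "(lamS s, a) \<in> V \<inter> map_prod lamS lamF ` topspace (prod_topology S F)"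
      using a D s by auto
    moreover have "direct_mul mulS mulF (lamS s, a) (s, y) \<in> U"
      using y B s by (auto simp: direct_mul_def)
    moreover have "map_prod lamS lamF (s, y) \<in> V"
      using y D by auto
    ultimately have "(s, y) \<in> topspace S \<times> Q"
      by (rule sub[rule_format])
    then show ?thesis by simp
  qed
  then have *: "\<forall>y \<in> topspace F. \<forall>a \<in> D \<inter> lamF ` topspace F. mulF a y \<in> B \<longrightarrow> lamF y \<in> D \<longrightarrow> y \<in> Q"
    by blast
  show "\<exists>U V. openin F U \<and> x \<in> U \<and> openin F V \<and> lamF x \<in> V \<and>
      (\<forall>y \<in> topspace F. \<forall>a \<in> V \<inter> lamF ` topspace F. mulF a y \<in> U \<longrightarrow> lamF y \<in> V \<longrightarrow> y \<in> Q)"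
    by (intro exI conjI) (fact B(1) B(3) D(1) D(3) *)+
qed

lemma topological_semigroup_semidirect:
  assumes "continuous_semigroup_action F mulF S mulS \<alpha>"
  shows "topological_semigroup (prod_topology S F) (semidirect_mul mulS mulF \<alpha>)"
proof -
  interpret continuous_semigroup_action F mulF S mulS \<alpha> by (fact assms)
  let ?P = "prod_topology S F"
  \<comment> \<open>Closure of the carriers is read off from continuity; it supplies the side
    conditions of the algebraic laws in the associativity proof.\<close>
  have act: "\<alpha> f s \<in> topspace S" if "f \<in> topspace F" "s \<in> topspace S" for f s
    using funcset_mem[OF continuous_map_funspace[OF continuous_action], of "(f, s)"] that by simp
  have mul: "mulS s t \<in> topspace S" if "s \<in> topspace S" "t \<in> topspace S" for s t
    using funcset_mem[OF continuous_map_funspace[OF S.continuous_mul], of "(s, t)"] that by simp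
  show ?thesis
  proof
    show "topspace ?P \<noteq> {}"
      using S.nonempty F.nonempty by simp
  next
    \<comment> \<open>The four coordinates of a pair \<open>((s, f), (t, g))\<close>; the
      multiplication is composed from them, the action and the two given multiplications.\<close>
    have s: "continuous_map (prod_topology ?P ?P) S (\<lambda>p. fst (fst p))"
      and f: "continuous_map (prod_topology ?P ?P) F (\<lambda>p. snd (fst p))"
      and t: "continuous_map (prod_topology ?P ?P) S (\<lambda>p. fst (snd p))"
      and g: "continuous_map (prod_topology ?P ?P) F (\<lambda>p. snd (snd p))"
      using continuous_map_compose[OF continuous_map_fst[of ?P ?P] continuous_map_fst[of S F]]
        continuous_map_compose[OF continuous_map_fst[of ?P ?P] continuous_map_snd[of S F]]
        continuous_map_compose[OF continuous_map_snd[of ?P ?P] continuous_map_fst[of S F]]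
        continuous_map_compose[OF continuous_map_snd[of ?P ?P] continuous_map_snd[of S F]]
      by (simp_all add: o_def)
    have "continuous_map (prod_topology ?P ?P) S (\<lambda>p. \<alpha> (snd (fst p)) (fst (snd p)))"
      using continuous_map_compose[OF continuous_map_pairedI[OF f t] continuous_action]
      by (simp add: o_def)
    from continuous_map_compose[OF continuous_map_pairedI[OF s this] S.continuous_mul]
    have "continuous_map (prod_topology ?P ?P) S
        (\<lambda>p. mulS (fst (fst p)) (\<alpha> (snd (fst p)) (fst (snd p))))"
      by (simp add: o_def)
    moreover have "continuous_map (prod_topology ?P ?P) F (\<lambda>p. mulF (snd (fst p)) (snd (snd p)))"
      using continuous_map_compose[OF continuous_map_pairedI[OF f g] F.continuous_mul]
      by (simp add: o_def)
    ultimately show "continuous_map (prod_topology ?P ?P) ?P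
        (\<lambda>(x, y). semidirect_mul mulS mulF \<alpha> x y)"
      by (simp add: semidirect_mul_def case_prod_unfold continuous_map_pairedI)
  next
    fix x y z
    assume "x \<in> topspace ?P" "y \<in> topspace ?P" "z \<in> topspace ?P"
    then show "semidirect_mul mulS mulF \<alpha> (semidirect_mul mulS mulF \<alpha> x y) z
        = semidirect_mul mulS mulF \<alpha> x (semidirect_mul mulS mulF \<alpha> y z)"
      \<comment> \<open>For factors \<open>(s, f)\<close>, \<open>(t, g)\<close>,
        \<open>(u, h)\<close>, both first coordinates become the product of \<open>s\<close>,
        \<open>\<alpha> f t\<close> and \<open>\<alpha> f (\<alpha> g u)\<close>: one side uses
        \<open>action_mul\<close>, the other \<open>action_hom\<close>.\<close>
      by (auto simp: semidirect_mul_def S.assoc F.assoc action_hom action_mul act mul)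
  qed
qed

theorem theorem7:
  fixes S :: "'s topology" and mulS :: "'s \<Rightarrow> 's \<Rightarrow> 's" and lamS :: "'s \<Rightarrow> 's"
    and F :: "'f topology" and mulF :: "'f \<Rightarrow> 'f \<Rightarrow> 'f" and lamF :: "'f \<Rightarrow> 'f"
    and \<alpha> :: "'f \<Rightarrow> 's \<Rightarrow> 's"
  assumes "topological_left_unosemigroup S mulS lamS"
    and "topological_left_unosemigroup F mulF lamF"
    and "continuous_semigroup_action F mulF S mulS \<alpha>"
    and "\<And>f s. \<lbrakk>f \<in> topspace F; s \<in> topspace S\<rbrakk> \<Longrightarrow> \<alpha> (lamF f) s = s"
  shows "ditopological_left_unosemigroup (prod_topology S F)
           (semidirect_mul mulS mulF \<alpha>) (map_prod lamS lamF)
         \<longleftrightarrow> ditopological_left_unosemigroup S mulS lamS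
           \<and> ditopological_left_unosemigroup F mulF lamF"
proof -
  interpret S: topological_left_unosemigroup S mulS lamS by (fact assms(1))
  interpret F: topological_left_unosemigroup F mulF lamF by (fact assms(2))
  interpret P: topological_semigroup "prod_topology S F" "semidirect_mul mulS mulF \<alpha>"
    by (rule topological_semigroup_semidirect) (fact assms(3))
  interpret P: topological_left_unosemigroup "prod_topology S F" "semidirect_mul mulS mulF \<alpha>"
    "map_prod lamS lamF"
  proof
    have "continuous_map (prod_topology S F) (prod_topology S F) (\<lambda>(s, f). (lamS s, lamF f))"
      using S.continuous_lam F.continuous_lam by (simp add: continuous_map_prod_top)
    then show "continuous_map (prod_topology S F) (prod_topology S F) (map_prod lamS lamF)"
      by (simp add: map_prod_def)
  \<comment> \<open>The unit law holds coordinatewise because \<open>\<alpha> (lamF f)\<close> fixes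
    every point of \<open>S\<close>.\<close>
  qed (auto simp: semidirect_mul_def S.left_unit F.left_unit assms(4))
  have "dicontinuous (prod_topology S F) (semidirect_mul mulS mulF \<alpha>) (map_prod lamS lamF)
      \<longleftrightarrow> dicontinuous (prod_topology S F) (direct_mul mulS mulF) (map_prod lamS lamF)"
    by (rule dicontinuous_cong) (auto simp: semidirect_mul_def direct_mul_def assms(4))
  also have "\<dots> \<longleftrightarrow> dicontinuous S mulS lamS \<and> dicontinuous F mulF lamF"
  proof -
    \<comment> \<open>Nonemptiness of the carriers provides the points at which the coordinates are
      frozen.\<close>
    obtain s f where "s \<in> topspace S" "f \<in> topspace F"
      using S.nonempty F.nonempty by blast
    then have "mulS (lamS s) s = s" "mulF (lamF f) f = f"
      by (simp_all add: S.left_unit F.left_unit)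
    with \<open>s \<in> topspace S\<close> \<open>f \<in> topspace F\<close> show ?thesis
      by (metis dicontinuous_direct_mul dicontinuous_direct_mul_fst dicontinuous_direct_mul_snd)
  qed
  \<comment> \<open>All three structures are already known to be topological left unosemigroups, so
    being ditopological amounts to dicontinuity for each.\<close>
  finally show ?thesis
    by (simp add: ditopological_left_unosemigroup_def ditopological_left_unosemigroup_axioms_def
        S.topological_left_unosemigroup_axioms F.topological_left_unosemigroup_axioms
        P.topological_left_unosemigroup_axioms)
qed

end
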